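(* There exists $n_6$ such that if $n>n_6$ the following holds. Let $m=\binom{n}{2}$, $M=\lceil m/2\rceil$, and for an integer $j$ let $\mathcal{G}^{(j)}$ denote the set of connected graphs on vertex set $[n]$ with exactly $j$ edges. If $k$ is an integer with $M+1\le k<M+n$, then there is a complete matching from $\mathcal{G}^{(k)}$ to $\mathcal{G}^{(k-1)}$.
   Context: Graphs are simple. A complete matching from $\mathcal{G}^{(k)}$ to $\mathcal{G}^{(l)}$ is an injection $f:\mathcal{G}^{(k)}\to\mathcal{G}^{(l)}$ such that for every $G\in\mathcal{G}^{(k)}$, the graphs $G$ and $f(G)$ are comparable, i.e. $E(G)\subseteq E(f(G))$ or $E(f(G))\subseteq E(G)$. *)

theory Defs
  imports Complex_Main "Graph_Theory.Digraph_Component"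
begin

text \<open>Simple graphs are the \<^locale>\<open>pair_graph\<close>s of the library: finite, loop-free, symmetric
  digraphs whose arcs are ordered pairs. An undirected edge is thus represented by two arcs;
  the following set contains each edge once.\<close>

definition undirected_edges :: "'a pair_pre_digraph \<Rightarrow> 'a set set" where
  "undirected_edges G = (\<lambda>(u, v). {u, v}) ` parcs G"

definition connected_graphs :: "nat \<Rightarrow> nat \<Rightarrow> nat pair_pre_digraph set" where
  "connected_graphs n j =
     {G. pair_graph G \<and> pverts G = {1..n} \<and> Digraph_Component.connected (with_proj G) \<and>
         card (undirected_edges G) = j}"

definition comparable :: "'a pair_pre_digraph \<Rightarrow> 'a pair_pre_digraph \<Rightarrow> bool" where
  "comparable G H \<longleftrightarrow>
     undirected_edges G \<subseteq> undirected_edges H \<or> undirected_edges H \<subseteq> undirected_edges G"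

definition complete_matching ::
  "'a pair_pre_digraph set \<Rightarrow> 'a pair_pre_digraph set \<Rightarrow>
    ('a pair_pre_digraph \<Rightarrow> 'a pair_pre_digraph) \<Rightarrow> bool" where
  "complete_matching \<A> \<B> f \<longleftrightarrow>
     f ` \<A> \<subseteq> \<B> \<and> inj_on f \<A> \<and> (\<forall>G\<in>\<A>. comparable G (f G))"

end

theory Submission
  imports Defs
begin

text \<open>By Hall's theorem a fractional matching suffices. Spreading the weight of a connected graph
  evenly over the connected graphs \<open>G - e\<close> overloads the graphs with two or more bridges, by about
  \<open>1 / k\<close> per bridge. So call a non-bridge \<open>e\<close> of \<open>G\<close> breaking if \<open>G - e\<close> has more bridges than
  \<open>G\<close>, let \<open>G\<close> send only \<open>\<beta> = (1 - 1 / S) / (k - 1)\<close> to \<open>G - e\<close> for each breaking \<open>e\<close>, where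
  \<open>S = 2 n / 3\<close>, and distribute the rest evenly over the other \<open>G - e\<close>. This works as soon as \<open>S\<close>
  bounds the number of breaking edges of every \<open>G\<close>, and every \<open>H\<close> with \<open>b\<close> bridges has at least
  \<open>b S\<close> non-edges whose addition destroys a bridge.

  Both bounds come from the fact that a graph with \<open>t\<close> bridges has at most \<open>C(n - t, 2) + t\<close>
  edges, whereas the graphs in question have about \<open>n\<^sup>2 / 4\<close>. For the first one, breaking edges come in
  pairs whose joint removal disconnects \<open>G\<close>, so that removing at most half of them turns all others
  into bridges.\<close>

section \<open>Connectivity of edge sets\<close>

text \<open>The closure is reflexive on the whole type, so no vertex set has to be carried along: a
  vertex on no edge is related to itself alone.\<close>

definition conn :: "'a set set \<Rightarrow> 'a rel" where
  "conn E = {(a, b). {a, b} \<in> E}\<^sup>*"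

text \<open>Phrased for a set, so that an unordered edge can be used without choosing an order of
  its endpoints.\<close>

definition joined :: "'a set set \<Rightarrow> 'a set \<Rightarrow> bool" where
  "joined E e \<longleftrightarrow> (\<forall>u\<in>e. \<forall>v\<in>e. (u, v) \<in> conn E)"

definition pairs :: "'a set \<Rightarrow> 'a set set" where
  "pairs V = {e. e \<subseteq> V \<and> card e = 2}"

definition bridges :: "'a set set \<Rightarrow> 'a set set" where
  "bridges E = {e \<in> E. \<not> joined (E - {e}) e}"

lemma conn_refl [simp]: "(u, u) \<in> conn E"
  by (simp add: conn_def)

lemma conn_sym: "(u, v) \<in> conn E \<Longrightarrow> (v, u) \<in> conn E"
proof -
  have "sym {(a, b). {a, b} \<in> E}"
    by (auto simp: sym_def insert_commute)
  from sym_rtrancl[OF this] show "(u, v) \<in> conn E \<Longrightarrow> (v, u) \<in> conn E"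
    unfolding conn_def by (rule symD)
qed

lemma conn_trans: "(u, v) \<in> conn E \<Longrightarrow> (v, w) \<in> conn E \<Longrightarrow> (u, w) \<in> conn E"
  unfolding conn_def by (rule rtrancl_trans)

lemma conn_mono: "E \<subseteq> F \<Longrightarrow> conn E \<subseteq> conn F"
  unfolding conn_def by (rule rtrancl_mono) auto

lemma conn_edge: "{a, b} \<in> E \<Longrightarrow> (a, b) \<in> conn E"
  unfolding conn_def by auto

text \<open>A walk that crosses the new edge several times can be cut short to one that crosses it
  at most once, in one of the two directions.\<close>

lemma conn_insert_cases:
  assumes "(u, v) \<in> conn (insert {a, b} E)"
  shows "(u, v) \<in> conn E \<or> (u, a) \<in> conn E \<and> (b, v) \<in> conn E
    \<or> (u, b) \<in> conn E \<and> (a, v) \<in> conn E"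
  using assms unfolding conn_def[of "insert {a, b} E"]
proof (induction rule: rtrancl_induct)
  case base
  then show ?case by simp
next
  case (step y z)
  then consider "{y, z} \<in> E" | "y = a" "z = b" | "y = b" "z = a"
    by (auto simp: doubleton_eq_iff)
  then show ?case
  proof cases
    case 1
    then have "(y, z) \<in> conn E" by (rule conn_edge)
    with step.IH show ?thesis by (meson conn_trans)
  qed (use step.IH conn_refl in \<open>auto\<close>)
qed

lemma conn_insert_same:
  assumes "(a, b) \<in> conn E"
  shows "conn (insert {a, b} E) = conn E"
proof
  show "conn (insert {a, b} E) \<subseteq> conn E"
  proof (rule subrelI)
    fix u v assume "(u, v) \<in> conn (insert {a, b} E)"
    from conn_insert_cases[OF this] show "(u, v) \<in> conn E"
      using assms by (blast intro: conn_sym conn_trans)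
  qed
qed (auto intro: conn_mono[THEN subsetD])

lemma joined_pair [simp]: "joined E {a, b} \<longleftrightarrow> (a, b) \<in> conn E"
  using conn_sym[of a b E] by (auto simp: joined_def)

lemma joined_mono: "joined E e \<Longrightarrow> E \<subseteq> F \<Longrightarrow> joined F e"
  using conn_mono[of E F] by (auto simp: joined_def)

lemma card_2E:
  assumes "card e = 2"
  obtains a b where "e = {a, b}" "a \<noteq> b"
  using assms by (meson card_2_iff)

lemma card_2_memberE:
  assumes "card e = 2" "x \<in> e"
  obtains y where "e = {x, y}" "x \<noteq> y"
proof -
  obtain a b where "e = {a, b}" "a \<noteq> b" using assms(1) by (rule card_2E)
  then show thesis using assms(2) that[of a] that[of b] by (auto simp: insert_commute)
qed

lemma joined_edge: "e \<in> E \<Longrightarrow> card e = 2 \<Longrightarrow> joined E e"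
  by (auto simp: card_2_iff conn_edge)

lemma conn_insert_joined: "card e = 2 \<Longrightarrow> joined E e \<Longrightarrow> conn (insert e E) = conn E"
  by (auto simp: card_2_iff conn_insert_same)

lemma joined_insert_joined: "card e = 2 \<Longrightarrow> joined E e \<Longrightarrow> joined (insert e E) f \<longleftrightarrow> joined E f"
  by (simp add: joined_def conn_insert_joined)

text \<open>The exchange property of the graphic matroid: a walk between the ends of
  \<open>e\<close> has to cross \<open>f\<close>, so its two remaining pieces together with
  \<open>e\<close> connect the ends of \<open>f\<close>.\<close>

lemma joined_exchange:
  assumes "card e = 2" "card f = 2" "joined (insert f E) e" "\<not> joined E e"
  shows "joined (insert e E) f"
proof -
  obtain u v where e: "e = {u, v}" using assms(1) by (rule card_2E)
  obtain a b where f: "f = {a, b}" using assms(2) by (rule card_2E)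
  have uv: "(u, v) \<in> conn (insert e E)"
    by (simp add: conn_edge e)
  have mono: "(x, y) \<in> conn (insert e E)" if "(x, y) \<in> conn E" for x y
    using that conn_mono[of E "insert e E"] by blast
  have "(u, v) \<in> conn (insert {a, b} E)" "(u, v) \<notin> conn E"
    using assms(3,4) by (simp_all add: e f)
  with conn_insert_cases[OF this(1)]
  consider "(u, a) \<in> conn E" "(b, v) \<in> conn E" | "(u, b) \<in> conn E" "(a, v) \<in> conn E"
    by blast
  then have "(a, b) \<in> conn (insert e E)"
  proof cases
    case 1
    from conn_trans[OF conn_trans[OF mono[OF conn_sym[OF 1(1)]] uv] mono[OF conn_sym[OF 1(2)]]]
    show ?thesis .
  next
    case 2
    from conn_trans[OF conn_trans[OF mono[OF 2(2)] conn_sym[OF uv]] mono[OF 2(1)]]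
    show ?thesis .
  qed
  then show ?thesis by (simp add: f)
qed

lemma bridges_subset: "bridges E \<subseteq> E"
  by (auto simp: bridges_def)

lemma bridge_mono: "e \<in> bridges E \<Longrightarrow> F \<subseteq> E \<Longrightarrow> e \<in> F \<Longrightarrow> e \<in> bridges F"
  unfolding bridges_def by (blast dest: joined_mono[of "F - {e}" e "E - {e}"])

lemma finite_pairs: "finite V \<Longrightarrow> finite (pairs V)"
  by (simp add: pairs_def)

lemma card_pairs: "finite V \<Longrightarrow> card (pairs V) = card V choose 2"
  unfolding pairs_def by (rule n_subsets)

lemma pairs_card: "e \<in> pairs V \<Longrightarrow> card e = 2"
  by (simp add: pairs_def)

lemma two_times_choose_two: "2 * int (a choose 2) = int a * (int a - 1)"
proof -
  have "even (a * (a - 1))" by (cases a) auto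
  then have "2 * (a choose 2) = a * (a - 1)" by (simp only: choose_two dvd_mult_div_cancel)
  then have "2 * int (a choose 2) = int (a * (a - 1))" by linarith
  then show ?thesis by (cases a) (simp_all add: algebra_simps)
qed

lemma choose_two_mono: "a \<le> b \<Longrightarrow> a choose 2 \<le> b choose 2"
  unfolding choose_two by (intro div_le_mono mult_le_mono diff_le_mono)

section \<open>Counting connected components\<close>

definition classes :: "'a set \<Rightarrow> 'a set set \<Rightarrow> 'a set set" where
  "classes V E = (\<lambda>u. conn E `` {u}) ` V"

lemma conn_class_eq_iff: "conn E `` {u} = conn E `` {v} \<longleftrightarrow> (u, v) \<in> conn E"
proof
  assume "conn E `` {u} = conn E `` {v}"
  moreover have "v \<in> conn E `` {v}" by simp
  ultimately have "v \<in> conn E `` {u}" by (simp only:)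
  then show "(u, v) \<in> conn E" by simp
next
  assume uv: "(u, v) \<in> conn E"
  have "(u, w) \<in> conn E \<longleftrightarrow> (v, w) \<in> conn E" for w
    using conn_trans[OF uv] conn_trans[OF conn_sym[OF uv]] by blast
  then show "conn E `` {u} = conn E `` {v}" by auto
qed

text \<open>Sending each class of \<open>E\<close> to the class of the larger edge set that contains
  it is onto, but identifies the classes of the two ends of \<open>e\<close>.\<close>

lemma card_classes_insert:
  assumes "finite V" "e \<in> pairs V" "\<not> joined E e"
  shows "card (classes V (insert e E)) < card (classes V E)"
proof -
  obtain a b where e: "e = {a, b}" using pairs_card[OF assms(2)] by (rule card_2E)
  have ab: "a \<in> V" "b \<in> V" "(a, b) \<notin> conn E"
    using assms(2,3) by (auto simp: e pairs_def)
  let ?F = "insert e E"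
  let ?h = "\<lambda>X. conn ?F `` X"
  have h: "?h (conn E `` {u}) = conn ?F `` {u}" for u
  proof -
    have "conn E \<subseteq> conn ?F" by (rule conn_mono) auto
    then have "conn E O conn ?F = conn ?F"
      by (auto intro: conn_trans relcompI[OF conn_refl])
    then show ?thesis
      by (metis relcomp_Image)
  qed
  have image: "?h ` classes V E = classes V ?F"
    by (simp add: classes_def image_image h)
  have fin: "finite (classes V E)"
    using assms(1) by (simp add: classes_def)
  have "\<not> inj_on ?h (classes V E)"
  proof
    assume inj: "inj_on ?h (classes V E)"
    have "conn ?F `` {a} = conn ?F `` {b}"
      unfolding conn_class_eq_iff by (simp add: e conn_edge)
    then have "?h (conn E `` {a}) = ?h (conn E `` {b})"
      by (simp only: h)
    then have "conn E `` {a} = conn E `` {b}"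
      by (rule inj_onD[OF inj]) (use ab(1,2) in \<open>simp_all add: classes_def\<close>)
    with ab show False by (simp only: conn_class_eq_iff)
  qed
  then have "card (?h ` classes V E) < card (classes V E)"
    using fin card_image_le eq_card_imp_inj_on by (metis le_neq_implies_less)
  then show ?thesis by (simp only: image)
qed

text \<open>The bridges are deleted one at a time. Each is still a bridge of what remains, so each
  deletion splits a class.\<close>

lemma card_classes_Diff_bridges:
  assumes "finite V" "E \<subseteq> pairs V" "F \<subseteq> bridges E"
  shows "card (classes V E) + card F \<le> card (classes V (E - F))"
proof -
  have "finite F"
    using assms bridges_subset finite_pairs by (metis finite_subset)
  then show ?thesis
    using assms(3)
  proof (induction rule: finite_induct)
    case empty
    then show ?case by simp
  next
    case (insert f F)
    have "insert f (E - insert f F) = E - F"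
      using insert bridges_subset[of E] by auto
    moreover have "\<not> joined (E - insert f F) f"
      using insert.prems joined_mono[of "E - insert f F" f "E - {f}"]
      by (auto simp: bridges_def)
    moreover have "f \<in> pairs V"
      using insert.prems bridges_subset assms(2) by auto
    ultimately have "card (classes V (E - F)) < card (classes V (E - insert f F))"
      using card_classes_insert[OF assms(1)] by metis
    with insert show ?case by simp
  qed
qed

text \<open>Choose a representative in each class and let \<open>W\<close> be the set of the other
  vertices. A joined pair contains at most one representative, and its trace on \<open>W\<close>
  determines it. So there are at most as many joined pairs as subsets of \<open>W\<close> of size 1
  or 2.\<close>

lemma card_joined_pairs_le:
  assumes "finite V"
  shows "card {e \<in> pairs V. joined E e} \<le> Suc (card V - card (classes V E)) choose 2"
proof -
  let ?c = "\<lambda>u. conn E `` {u}"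
  obtain R where R: "R \<subseteq> V" "inj_on ?c R" "classes V E = ?c ` R"
    unfolding classes_def using subset_image_inj[THEN iffD1, OF subset_refl[of "?c ` V"]] by blast
  define W where "W = V - R"
  have finR: "finite R" "finite W"
    using assms R(1) by (auto simp: W_def intro: finite_subset)
  have cardW: "card W = card V - card (classes V E)"
    using R(1) card_image[OF R(2)] finR(1) by (simp only: W_def card_Diff_subset R(3))
  let ?K = "{e \<in> pairs V. joined E e}"
  have uniq: "r = r'" if "r \<in> R" "r' \<in> R" "(r, r') \<in> conn E" for r r'
    using that by (intro inj_onD[OF R(2)]) (simp_all only: conn_class_eq_iff)
  have inj: "inj_on (\<lambda>e. e \<inter> W) ?K"
  proof (rule inj_onI)
    fix e e' assume e: "e \<in> ?K" and e': "e' \<in> ?K" and eq: "e \<inter> W = e' \<inter> W"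
    \<comment> \<open>If \<open>x\<close> is a representative, it is the one of the class of the
      other end \<open>y\<close> of \<open>e\<close>. The trace \<open>{y}\<close> is shared by
      \<open>e'\<close>, whose second vertex must then be the representative of that same
      class.\<close>
    have *: "x \<in> e'" if prem: "e \<in> ?K" "e' \<in> ?K" "e \<inter> W = e' \<inter> W" "x \<in> e" for e e' x
    proof (cases "x \<in> W")
      case True
      with prem show ?thesis by blast
    next
      case False
      obtain y where y: "e = {x, y}" "x \<noteq> y"
        using card_2_memberE[OF pairs_card prem(4)] prem(1) by blast
      have xR: "x \<in> R" and xy: "(x, y) \<in> conn E" and yV: "y \<in> V"
        using prem(1) False by (auto simp: W_def pairs_def y(1))
      then have "y \<in> W"
        using uniq[OF xR _ xy] y(2) by (auto simp: W_def)
      have "e \<inter> W = {y}"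
        using \<open>y \<in> W\<close> False by (auto simp: y(1))
      then have e'W: "e' \<inter> W = {y}"
        using prem(3) by (simp only:)
      then have "y \<in> e'" by blast
      obtain z where z: "e' = {y, z}" "y \<noteq> z"
        using card_2_memberE[OF pairs_card \<open>y \<in> e'\<close>] prem(2) by blast
      have "z \<notin> W"
      proof
        assume "z \<in> W"
        then have "z \<in> e' \<inter> W" by (simp add: z(1))
        then have "z \<in> {y}" by (simp only: e'W)
        with z(2) show False by simp
      qed
      then have "z \<in> R" using prem(2) z(1) by (auto simp: W_def pairs_def)
      moreover have "(y, z) \<in> conn E" using prem(2) z by auto
      ultimately have "x = z" using uniq[OF xR _ conn_trans[OF xy]] by blast
      with z show ?thesis by simp
    qed
    show "e = e'"
      using *[OF e e' eq] *[OF e' e eq[symmetric]] by blast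
  qed
  have image: "(\<lambda>e. e \<inter> W) ` ?K \<subseteq> {X. X \<subseteq> W \<and> card X = 1} \<union> {X. X \<subseteq> W \<and> card X = 2}"
  proof
    fix X assume "X \<in> (\<lambda>e. e \<inter> W) ` ?K"
    then obtain e where e: "e \<in> ?K" "X = e \<inter> W" by auto
    obtain x y where xy: "e = {x, y}" "x \<noteq> y"
      using e by (auto simp: pairs_def card_2_iff)
    have "x \<in> W \<or> y \<in> W"
      using e uniq[of x y] xy by (auto simp: W_def pairs_def)
    then consider "X = {x}" | "X = {y}" | "X = {x, y}"
      using e(2) xy(1) by auto
    moreover have "X \<subseteq> W" using e(2) by simp
    ultimately show "X \<in> {X. X \<subseteq> W \<and> card X = 1} \<union> {X. X \<subseteq> W \<and> card X = 2}"
      using xy(2) by cases simp_all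
  qed
  have "card ?K \<le> card ({X. X \<subseteq> W \<and> card X = 1} \<union> {X. X \<subseteq> W \<and> card X = 2})"
    using inj image by (rule card_inj_on_le) (simp add: finR)
  also have "\<dots> \<le> (card W choose 1) + (card W choose 2)"
    using card_Un_le[of "{X. X \<subseteq> W \<and> card X = 1}" "{X. X \<subseteq> W \<and> card X = 2}"]
    by (simp only: n_subsets[OF finR(2)])
  also have "\<dots> = Suc (card W) choose 2"
    by (simp add: numeral_2_eq_2)
  finally show ?thesis by (simp add: cardW)
qed

text \<open>There is at least one class before the deletion and every bridge in \<open>F\<close>
  adds one, so \<open>E - F\<close> has more than \<open>card F\<close> classes, while there are
  never more classes than vertices.\<close>

lemma card_joined_Diff_bridges:
  assumes "finite V" "V \<noteq> {}" "E \<subseteq> pairs V" "F \<subseteq> bridges E"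
  shows "card {e \<in> pairs V. joined (E - F) e} \<le> (card V - card F) choose 2"
    and "card F < card V"
proof -
  have "classes V E \<noteq> {}" "finite (classes V E)"
    using assms by (auto simp: classes_def)
  then have pos: "card (classes V E) > 0" by (simp add: card_gt_0_iff)
  have le: "card (classes V (E - F)) \<le> card V"
    unfolding classes_def using assms(1) by (rule card_image_le)
  have F: "card (classes V E) + card F \<le> card (classes V (E - F))"
    using assms(1,3,4) by (rule card_classes_Diff_bridges)
  with pos le show "card F < card V" by linarith
  have "card {e \<in> pairs V. joined (E - F) e}
      \<le> Suc (card V - card (classes V (E - F))) choose 2"
    using assms(1) by (rule card_joined_pairs_le)
  also have "\<dots> \<le> (card V - card F) choose 2"
    using F pos le by (intro choose_two_mono) linarith
  finally show "card {e \<in> pairs V. joined (E - F) e} \<le> (card V - card F) choose 2" .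
qed

lemma card_le_with_bridges:
  assumes "finite V" "V \<noteq> {}" "E \<subseteq> pairs V" "F \<subseteq> bridges E"
  shows "card E \<le> ((card V - card F) choose 2) + card F"
proof -
  have fin: "finite E"
    using assms(3) finite_pairs[OF assms(1)] by (rule finite_subset)
  have FE: "F \<subseteq> E"
    using assms(4) bridges_subset by (rule subset_trans)
  have "E - F \<subseteq> {e \<in> pairs V. joined (E - F) e}"
    using assms(3) joined_edge[of _ "E - F"] pairs_card by blast
  then have "card (E - F) \<le> card {e \<in> pairs V. joined (E - F) e}"
    using finite_pairs[OF assms(1)] by (intro card_mono) auto
  also have "\<dots> \<le> (card V - card F) choose 2"
    using assms by (rule card_joined_Diff_bridges)
  finally have "card (E - F) \<le> (card V - card F) choose 2" .
  moreover have "card E = card (E - F) + card F"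
    using fin FE by (simp add: card_Diff_subset finite_subset card_mono)
  ultimately show ?thesis by linarith
qed

text \<open>Were \<open>t\<close> at least \<open>n / 3\<close>, then \<open>k\<close> would be too
  small to reach half of all pairs. The summand \<open>2 * t\<close> serves the count of breaking
  edges, where up to \<open>t\<close> deleted edges come on top of \<open>t\<close> bridges. The
  constant 22 is the least that excludes \<open>t = n / 3\<close>: there the two bounds on
  \<open>k\<close> are compatible up to \<open>n = 21\<close>.\<close>

lemma three_times_less_of_quadratic:
  fixes n t k :: nat
  assumes "t < n" "22 \<le> n" "n choose 2 \<le> 2 * k" "k \<le> ((n - t) choose 2) + 2 * t"
  shows "3 * t < n"
proof (rule ccontr)
  assume "\<not> 3 * t < n"
  define N T K where NTK: "N = int n" "T = int t" "K = int k"
  have bounds: "N \<le> 3 * T" "T \<le> N - 1" "22 \<le> N"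
    using \<open>\<not> 3 * t < n\<close> assms(1,2) by (auto simp: NTK)
  have "2 * int ((n - t) choose 2) = (N - T) * (N - T - 1)"
    using assms(1) by (simp add: two_times_choose_two NTK of_nat_diff)
  then have upper: "2 * K \<le> (N - T) * (N - T - 1) + 4 * T"
    using assms(4) unfolding NTK by linarith
  have lower: "N * (N - 1) \<le> 4 * K"
    using assms(3) two_times_choose_two[of n] unfolding NTK by linarith
  \<comment> \<open>The upper bound on \<open>K\<close> is convex in \<open>T\<close>. This product
    replaces the square of \<open>T\<close> by its chord over the interval from \<open>N / 3\<close>
    to \<open>N - 1\<close>.\<close>
  have "0 \<le> (3 * T - N) * (N - 1 - T)"
    using bounds by (intro mult_nonneg_nonneg) auto
  then have "3 * (T * T) \<le> 4 * (N * T) - 3 * T - N * N + N"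
    by (simp add: algebra_simps)
  \<comment> \<open>The resulting linear bound decreases in \<open>T\<close> with slope proportional
    to \<open>N - 6\<close>, so \<open>T = N / 3\<close> is the worst case.\<close>
  moreover have "0 \<le> (3 * T - N) * (N - 6)"
    using bounds by (intro mult_nonneg_nonneg) auto
  then have "N * N - 6 * N \<le> 3 * (N * T) - 18 * T"
    by (simp add: algebra_simps)
  moreover have "2 * K \<le> N * N - 2 * (N * T) + T * T - N + 5 * T"
    using upper by (simp add: algebra_simps)
  moreover have "N * N - N \<le> 4 * K"
    using lower by (simp add: algebra_simps)
  moreover have "22 * N \<le> N * N"
    using bounds by (intro mult_right_mono) auto
  ultimately show False
    using bounds by linarith
qed

section \<open>Edges whose removal creates bridges\<close>

definition breaking :: "'a set set \<Rightarrow> 'a set set" where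
  "breaking E = {e \<in> E - bridges E. bridges (E - {e}) \<noteq> bridges E}"

definition cgraphs :: "'a set \<Rightarrow> nat \<Rightarrow> 'a set set set" where
  "cgraphs V k = {E. E \<subseteq> pairs V \<and> card E = k \<and> (\<forall>e\<in>pairs V. joined E e)}"

lemma nonbridge_joined_iff:
  assumes "e \<in> E - bridges E" "card e = 2"
  shows "joined (E - {e}) f \<longleftrightarrow> joined E f"
proof -
  have "joined (E - {e}) e"
    using assms(1) by (simp add: bridges_def)
  from joined_insert_joined[OF assms(2) this, of f] show ?thesis
    using assms(1) by (simp add: insert_absorb)
qed

lemma bridges_Diff_superset:
  assumes "e \<notin> bridges E"
  shows "bridges E \<subseteq> bridges (E - {e})"
proof
  fix f assume f: "f \<in> bridges E"
  then have "f \<in> E - {e}"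
    using assms bridges_subset[of E] by blast
  with f show "f \<in> bridges (E - {e})"
    by (intro bridge_mono[OF f]) auto
qed

text \<open>If \<open>e\<close> were joined without \<open>e\<close> and \<open>f\<close>, putting
  \<open>e\<close> back would leave connectivity unchanged, so \<open>f\<close> would not be joined
  in \<open>E - {f}\<close> either.\<close>

lemma cut_pair_sym:
  assumes "card e = 2" "e \<in> E" "f \<in> E" "e \<noteq> f" "joined (E - {f}) f"
    "\<not> joined (E - {e, f}) f"
  shows "\<not> joined (E - {e, f}) e"
proof
  assume "joined (E - {e, f}) e"
  from joined_insert_joined[OF assms(1) this, of f]
  have "\<not> joined (insert e (E - {e, f})) f"
    using assms(6) by simp
  moreover have "insert e (E - {e, f}) = E - {f}"
    using assms(2-4) by auto
  ultimately show False
    using assms(5) by simp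
qed

text \<open>Any bridge \<open>f\<close> that appears when \<open>e\<close> is deleted will do:
  \<open>e\<close> and \<open>f\<close> form a two-edge cut, so conversely the deletion of
  \<open>f\<close> turns \<open>e\<close> into a bridge.\<close>

lemma breaking_partner:
  assumes "E \<subseteq> pairs V" "e \<in> breaking E"
  obtains f where "f \<in> breaking E" "f \<noteq> e" "\<not> joined (E - {e, f}) f"
proof -
  have e: "e \<in> E" "e \<notin> bridges E" "card e = 2"
    using assms pairs_card by (auto simp: breaking_def)
  have "bridges E \<subseteq> bridges (E - {e})"
    using e(2) by (rule bridges_Diff_superset)
  then obtain f where f: "f \<in> bridges (E - {e})" "f \<notin> bridges E"
    using assms(2) by (auto simp: breaking_def)
  have Diff: "E - {e} - {f} = E - {e, f}" "E - {f} - {e} = E - {e, f}"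
    by auto
  have f': "f \<in> E" "f \<noteq> e" "\<not> joined (E - {e, f}) f" "joined (E - {f}) f"
    using f by (auto simp: bridges_def Diff)
  have "\<not> joined (E - {e, f}) e"
    by (rule cut_pair_sym) (use e f' in auto)
  then have "e \<in> bridges (E - {f})"
    using e(1) f'(2) by (auto simp: bridges_def Diff)
  with e(2) f'(1) f(2) have "f \<in> breaking E"
    by (auto simp: breaking_def)
  with f' show thesis by (intro that)
qed

text \<open>Ore's argument: the complement of a minimal dominating set is dominating, so one of the two
  has at most half of the elements.\<close>

lemma half_dominating_set:
  assumes "finite S"
    and sym: "\<And>x y. x \<in> S \<Longrightarrow> y \<in> S \<Longrightarrow> P x y \<Longrightarrow> P y x"
    and ex: "\<And>x. x \<in> S \<Longrightarrow> \<exists>y\<in>S. y \<noteq> x \<and> P x y"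
  obtains D where "D \<subseteq> S" "2 * card D \<le> card S" "\<And>x. x \<in> S - D \<Longrightarrow> \<exists>y\<in>D. P x y"
proof -
  define dom where "dom D \<longleftrightarrow> D \<subseteq> S \<and> (\<forall>x\<in>S - D. \<exists>y\<in>D. P x y)" for D
  have "dom S" by (simp add: dom_def)
  then obtain D where D: "dom D" and least: "\<And>D'. dom D' \<Longrightarrow> card D \<le> card D'"
    using ex_has_least_nat[of dom S card] by blast
  have DS: "D \<subseteq> S" using D by (simp add: dom_def)
  have finD: "finite D" using DS assms(1) by (rule finite_subset)
  have "dom (S - D)"
  proof (rule ccontr)
    assume "\<not> dom (S - D)"
    \<comment> \<open>Such a \<open>d\<close> has no neighbour outside \<open>D\<close>, hence one
      inside \<open>D\<close>, and no outside element relies on it. So \<open>D - {d}\<close> still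
      dominates, against minimality.\<close>
    then obtain d where d: "d \<in> D" "\<And>y. y \<in> S - D \<Longrightarrow> \<not> P d y"
      using DS by (auto simp: dom_def)
    have "\<exists>y\<in>D - {d}. P x y" if x: "x \<in> S - (D - {d})" for x
    proof (cases "x = d")
      case True
      obtain y where "y \<in> S" "y \<noteq> d" "P d y"
        using ex[of d] d(1) DS by blast
      then show ?thesis using d(2) True by blast
    next
      case False
      with x have "x \<in> S - D" by blast
      then obtain y where "y \<in> D" "P x y" using D by (auto simp: dom_def)
      moreover have "y \<noteq> d"
        using \<open>x \<in> S - D\<close> \<open>P x y\<close> \<open>y \<in> D\<close> DS d(2) sym[of x y] by blast
      ultimately show ?thesis by blast
    qed
    then have "dom (D - {d})" using DS by (auto simp: dom_def)
    then have "card D \<le> card (D - {d})" by (rule least)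
    moreover have "card (D - {d}) < card D" using finD d(1) by (rule card_Diff1_less)
    ultimately show False by simp
  qed
  then have "card D \<le> card (S - D)" by (rule least)
  then have "2 * card D \<le> card S"
    using DS finD by (simp add: card_Diff_subset)
  with DS show thesis
    using D by (intro that) (auto simp: dom_def)
qed

text \<open>Let \<open>D\<close> be a dominating set, for the relation of forming a two-edge cut,
  with at most half of the breaking edges. Once \<open>D\<close> is deleted, the other
  \<open>t\<close> breaking edges are bridges, so \<open>E\<close> has at most
  \<open>C(n - t, 2) + t\<close> edges plus the at most \<open>t\<close> edges of \<open>D\<close>.
  This forces \<open>3 * t < n\<close>, and there are at most \<open>2 * t\<close> breaking
  edges.\<close>

lemma card_breaking_less:
  assumes "finite V" "22 \<le> card V" "E \<subseteq> pairs V" "card V choose 2 \<le> 2 * card E"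
  shows "3 * card (breaking E) < 2 * card V"
proof -
  have fin: "finite E"
    using assms(3) finite_pairs[OF assms(1)] by (rule finite_subset)
  let ?S = "breaking E"
  have SE: "?S \<subseteq> E" by (auto simp: breaking_def)
  have finS: "finite ?S" using SE fin by (rule finite_subset)
  have Sprop: "card e = 2" "e \<in> E" "joined (E - {e}) e" if "e \<in> ?S" for e
    using that assms(3) pairs_card by (auto simp: breaking_def bridges_def)
  have sym: "\<not> joined (E - {f, e}) e" if "e \<in> ?S" "f \<in> ?S" "\<not> joined (E - {e, f}) f" for e f
    using that cut_pair_sym[of e E f] Sprop[OF that(1)] Sprop[OF that(2)]
    by (cases "e = f") (simp_all add: insert_commute)
  obtain D where D: "D \<subseteq> ?S" "2 * card D \<le> card ?S"
      "\<And>e. e \<in> ?S - D \<Longrightarrow> \<exists>f\<in>D. \<not> joined (E - {e, f}) f"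
  proof (rule half_dominating_set[of ?S "\<lambda>e f. \<not> joined (E - {e, f}) f"])
    show "\<exists>f\<in>?S. f \<noteq> e \<and> \<not> joined (E - {e, f}) f" if "e \<in> ?S" for e
      using breaking_partner[OF assms(3) that] by blast
  qed (use finS sym in blast)+
  have "?S - D \<subseteq> bridges (E - D)"
  proof
    fix e assume e: "e \<in> ?S - D"
    then obtain f where f: "f \<in> D" "\<not> joined (E - {e, f}) f" using D(3) by blast
    then have "\<not> joined (E - {f, e}) e" using sym e D(1) by blast
    moreover have "E - D - {e} \<subseteq> E - {f, e}" using f(1) by blast
    ultimately have "\<not> joined (E - D - {e}) e" using joined_mono by blast
    then show "e \<in> bridges (E - D)" using e SE by (auto simp: bridges_def)
  qed
  moreover have "V \<noteq> {}" using assms(2) by auto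
  moreover have "E - D \<subseteq> pairs V" using assms(3) by blast
  ultimately have le: "card (E - D) \<le> ((card V - card (?S - D)) choose 2) + card (?S - D)"
    and less: "card (?S - D) < card V"
    using card_le_with_bridges[OF assms(1)] card_joined_Diff_bridges(2)[OF assms(1)] by blast+
  have cards: "card ?S = card D + card (?S - D)" "card E = card D + card (E - D)"
    using D(1) SE finS fin by (simp_all add: card_Diff_subset finite_subset card_mono)
  have "3 * card (?S - D) < card V"
    using less assms(2,4)
    by (rule three_times_less_of_quadratic) (use le cards D(2) in linarith)
  then show ?thesis
    using cards(1) D(2) by linarith
qed

section \<open>Non-edges whose addition destroys a bridge\<close>

text \<open>Put the elements of \<open>F\<close> back one by one. The first one that joins the ends
  of \<open>e\<close> can be exchanged for \<open>e\<close>, and the further elements do no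
  harm.\<close>

lemma joined_Un_exchange:
  assumes "finite F" "\<And>f. f \<in> F \<Longrightarrow> card f = 2" "card e = 2" "X \<inter> F = {}"
    "joined (X \<union> F) e" "\<not> joined X e"
  shows "\<exists>f\<in>F. joined (insert e (X \<union> F - {f})) f"
  using assms
proof (induction F rule: finite_induct)
  case empty
  then show ?case by simp
next
  case (insert f F)
  show ?case
  proof (cases "joined (X \<union> F) e")
    case True
    then obtain f' where f': "f' \<in> F" "joined (insert e (X \<union> F - {f'})) f'"
      using insert by auto
    have "insert e (X \<union> F - {f'}) \<subseteq> insert e (X \<union> insert f F - {f'})" by blast
    with f'(2) have "joined (insert e (X \<union> insert f F - {f'})) f'" by (rule joined_mono)
    with f'(1) show ?thesis by blast
  next
    case False
    have "card f = 2" by (rule insert.prems(1)) simp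
    have "joined (insert f (X \<union> F)) e" using insert.prems(4) by (simp only: Un_insert_right)
    from joined_exchange[OF insert.prems(2) \<open>card f = 2\<close> this False]
    have "joined (insert e (X \<union> F)) f" .
    moreover have "f \<notin> X" using insert.prems(3) by simp
    then have "X \<union> insert f F - {f} = X \<union> F"
      using insert.hyps(2) by simp
    ultimately show ?thesis by simp
  qed
qed

text \<open>Otherwise the ends of \<open>e\<close> lie in different components of \<open>H\<close>
  without its bridges, so some bridge of \<open>H\<close> lies on a cycle through \<open>e\<close>
  and ceases to be a bridge.\<close>

lemma joined_Diff_bridges_if_same:
  assumes "finite V" "H \<in> cgraphs V k" "e \<in> pairs V - H" "bridges (insert e H) = bridges H"
  shows "joined (H - bridges H) e"
proof (rule ccontr)
  assume neg: "\<not> joined (H - bridges H) e"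
  have H: "H \<subseteq> pairs V" "joined H e" using assms(2,3) by (auto simp: cgraphs_def)
  have Un: "H - bridges H \<union> bridges H = H" using bridges_subset[of H] by blast
  have "\<exists>f\<in>bridges H. joined (insert e (H - bridges H \<union> bridges H - {f})) f"
  proof (rule joined_Un_exchange)
    have "bridges H \<subseteq> pairs V" using H(1) bridges_subset by blast
    then show "finite (bridges H)" using finite_pairs[OF assms(1)] by (rule finite_subset)
    show "\<And>f. f \<in> bridges H \<Longrightarrow> card f = 2"
      using \<open>bridges H \<subseteq> pairs V\<close> pairs_card by blast
    show "card e = 2" using assms(3) pairs_card by blast
    show "joined (H - bridges H \<union> bridges H) e" unfolding Un by (rule H(2))
  qed (use neg in auto)
  then obtain f where f: "f \<in> bridges H" "joined (insert e (H - {f})) f"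
    unfolding Un by blast
  have "f \<noteq> e" using f(1) bridges_subset[of H] assms(3) by blast
  then have "insert e (H - {f}) = insert e H - {f}" by auto
  with f(2) have "f \<notin> bridges (insert e H)" by (simp add: bridges_def)
  with f(1) assms(4) show False by simp
qed

lemma card_bridges_less:
  assumes "finite V" "22 \<le> card V" "H \<in> cgraphs V k" "card V choose 2 \<le> 2 * k"
  shows "3 * card (bridges H) < card V"
proof -
  have H: "H \<subseteq> pairs V" "card H = k" using assms(3) by (auto simp: cgraphs_def)
  have V: "V \<noteq> {}" using assms(2) by auto
  have less: "card (bridges H) < card V"
    using assms(1) V H(1) order_refl by (rule card_joined_Diff_bridges)
  have "card H \<le> ((card V - card (bridges H)) choose 2) + card (bridges H)"
    using assms(1) V H(1) order_refl by (rule card_le_with_bridges)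
  then show ?thesis
    using H(2) by (intro three_times_less_of_quadratic[OF less assms(2,4)]) linarith
qed

text \<open>With \<open>b\<close> bridges, every pair is a bridge, or joined in \<open>H\<close>
  without its bridges, or a non-edge that destroys a bridge. The second kind numbers at most
  \<open>C(n - b, 2)\<close>, which leaves roughly \<open>b * n\<close> pairs for the third.\<close>

lemma card_bridges_le_card_changing:
  assumes "finite V" "22 \<le> card V" "H \<in> cgraphs V k" "card V choose 2 \<le> 2 * k"
  shows "2 * card V * card (bridges H) \<le> 3 * card {e \<in> pairs V - H. bridges (insert e H) \<noteq> bridges H}"
proof -
  let ?n = "card V" and ?B = "bridges H"
  let ?C = "{e \<in> pairs V - H. bridges (insert e H) \<noteq> bridges H}"
  let ?I = "{e \<in> pairs V - H. bridges (insert e H) = bridges H}"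
  have H: "H \<subseteq> pairs V" "card H = k" using assms(3) by (auto simp: cgraphs_def)
  have finP: "finite (pairs V)" using assms(1) by (rule finite_pairs)
  have finH: "finite H" using H(1) finP by (rule finite_subset)
  have BH: "?B \<subseteq> H" by (rule bridges_subset)
  have V: "V \<noteq> {}" using assms(2) by auto
  have less: "card ?B < ?n"
    using assms(1) V H(1) order_refl by (rule card_joined_Diff_bridges)
  have b: "3 * card ?B < ?n"
    using assms by (rule card_bridges_less)
  have "?I \<union> (H - ?B) \<subseteq> {e \<in> pairs V. joined (H - ?B) e}"
    using joined_Diff_bridges_if_same[OF assms(1,3)] joined_edge[of _ "H - ?B"] pairs_card H(1)
    by blast
  then have "card (?I \<union> (H - ?B)) \<le> card {e \<in> pairs V. joined (H - ?B) e}"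
    using finP by (intro card_mono) auto
  also have "\<dots> \<le> (?n - card ?B) choose 2"
    using assms(1) V H(1) order_refl by (rule card_joined_Diff_bridges)
  finally have "card (?I \<union> (H - ?B)) \<le> (?n - card ?B) choose 2" .
  moreover have "card (?I \<union> (H - ?B)) = card ?I + card (H - ?B)"
    using finP finH by (intro card_Un_disjoint) auto
  moreover have "card H = card (H - ?B) + card ?B"
    using finH BH by (simp add: card_Diff_subset finite_subset card_mono)
  ultimately have I: "card ?I + card H \<le> ((?n - card ?B) choose 2) + card ?B"
    by linarith
  have "pairs V = H \<union> (?I \<union> ?C)" using H(1) by blast
  then have "card (pairs V) = card (H \<union> (?I \<union> ?C))" by simp
  also have "\<dots> = card H + card (?I \<union> ?C)"
    using finP finH by (intro card_Un_disjoint) auto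
  also have "card (?I \<union> ?C) = card ?I + card ?C"
    using finP by (intro card_Un_disjoint) auto
  finally have "?n choose 2 \<le> ((?n - card ?B) choose 2) + card ?B + card ?C"
    using I by (simp add: card_pairs[OF assms(1)])
  moreover define N B C where NBC: "N = int ?n" "B = int (card ?B)" "C = int (card ?C)"
  moreover have "2 * int ((?n - card ?B) choose 2) = (N - B) * (N - B - 1)"
    using less by (simp add: two_times_choose_two NBC of_nat_diff)
  ultimately have "N * (N - 1) \<le> (N - B) * (N - B - 1) + 2 * B + 2 * C"
    using two_times_choose_two[of ?n] unfolding NBC by linarith
  then have "2 * (N * B) \<le> B * B + 3 * B + 2 * C"
    by (simp add: algebra_simps)
  \<comment> \<open>Both lower-order terms are absorbed into \<open>N * B\<close>: the square by
    \<open>3 * b < n\<close>, the linear term by \<open>22 \<le> n\<close>.\<close>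
  moreover have "(3 * B) * B \<le> N * B" "22 * B \<le> N * B"
    using b assms(2) by (auto simp: NBC intro!: mult_right_mono)
  ultimately have "2 * (N * B) \<le> 3 * C"
    using b by (simp add: NBC)
  then have "int (2 * ?n * card ?B) \<le> int (3 * card ?C)"
    by (simp add: NBC)
  then show ?thesis by (simp only: of_nat_le_iff)
qed

text \<open>\<open>H\<close> is already connected, so \<open>e\<close> closes a cycle and is no
  bridge itself. Consequently a bridgeless \<open>H\<close> has no non-edge that changes its
  bridges.\<close>

lemma bridges_insert_subset:
  assumes "H \<in> cgraphs V k" "e \<in> pairs V - H"
  shows "bridges (insert e H) \<subseteq> bridges H"
proof
  fix f assume f: "f \<in> bridges (insert e H)"
  have "joined H e" using assms by (auto simp: cgraphs_def)
  moreover have "insert e H - {e} = H" using assms(2) by simp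
  ultimately have "joined (insert e H - {e}) e" by (simp only:)
  with f have "f \<noteq> e" unfolding bridges_def by blast
  then have "f \<in> H" using f bridges_subset[of "insert e H"] by blast
  then show "f \<in> bridges H" by (intro bridge_mono[OF f]) auto
qed

section \<open>From fractional to integral matchings\<close>

text \<open>Hall's theorem by the Halmos--Vaughan induction: split the index set at a proper nonempty
  subset for which the condition is tight, or else match any element arbitrarily.\<close>

lemma hall:
  assumes "finite I" "\<And>i. i \<in> I \<Longrightarrow> finite (A i)"
    "\<And>J. J \<subseteq> I \<Longrightarrow> card J \<le> card (\<Union>i\<in>J. A i)"
  shows "\<exists>f. inj_on f I \<and> (\<forall>i\<in>I. f i \<in> A i)"
  using assms
proof (induction I arbitrary: A rule: finite_psubset_induct)
  case (psubset I)
  note fin = psubset.hyps and finA = psubset.prems(1) and hall = psubset.prems(2)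
  show ?case
  proof (cases "\<exists>J. J \<noteq> {} \<and> J \<subset> I \<and> card (\<Union>i\<in>J. A i) = card J")
    case True
    then obtain J where J: "J \<noteq> {}" "J \<subset> I" "card (\<Union>i\<in>J. A i) = card J" by blast
    let ?U = "\<Union>i\<in>J. A i"
    have finJ: "finite J" using J(2) fin by (meson finite_subset psubset_imp_subset)
    have finU: "finite ?U" using finJ finA J(2) by (intro finite_UN_I) auto
    have "\<exists>f. inj_on f J \<and> (\<forall>i\<in>J. f i \<in> A i)"
    proof (rule psubset.IH[OF J(2)])
      show "finite (A i)" if "i \<in> J" for i using that finA J(2) by blast
      show "card K \<le> card (\<Union>i\<in>K. A i)" if "K \<subseteq> J" for K
        using that J(2) by (intro hall) auto
    qed
    then obtain f where f: "inj_on f J" "\<And>i. i \<in> J \<Longrightarrow> f i \<in> A i" by blast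
    have "I - J \<subset> I" using J(1,2) by blast
    then have "\<exists>g. inj_on g (I - J) \<and> (\<forall>i\<in>I - J. g i \<in> A i - ?U)"
    proof (rule psubset.IH)
      show "finite (A i - ?U)" if "i \<in> I - J" for i using that finA by blast
      show "card K \<le> card (\<Union>i\<in>K. A i - ?U)" if K: "K \<subseteq> I - J" for K
      proof -
        have finK: "finite K" using K fin by (meson finite_Diff finite_subset)
        have fin': "finite (\<Union>i\<in>K. A i - ?U)"
          using finK K finA by (intro finite_UN_I) auto
        \<comment> \<open>Tightness of \<open>J\<close> lets its neighbourhood be subtracted from
          the condition for \<open>J \<union> K\<close>.\<close>
        have "card J + card K = card (J \<union> K)"
          using finJ finK K by (intro card_Un_disjoint[symmetric]) auto
        also have "\<dots> \<le> card (\<Union>i\<in>J \<union> K. A i)"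
          using K J(2) by (intro hall) auto
        also have "(\<Union>i\<in>J \<union> K. A i) = ?U \<union> (\<Union>i\<in>K. A i - ?U)" by blast
        also have "card \<dots> = card ?U + card (\<Union>i\<in>K. A i - ?U)"
          using finU fin' by (intro card_Un_disjoint) auto
        finally show ?thesis using J(3) by simp
      qed
    qed
    then obtain g where g: "inj_on g (I - J)" "\<And>i. i \<in> I - J \<Longrightarrow> g i \<in> A i - ?U" by blast
    let ?h = "\<lambda>i. if i \<in> J then f i else g i"
    have "inj_on ?h (J \<union> (I - J))"
      unfolding inj_on_Un
    proof (intro conjI)
      show "inj_on ?h J" using f(1) by (simp add: inj_on_def)
      show "inj_on ?h (I - J)" using g(1) by (simp add: inj_on_def)
      show "?h ` (J - (I - J)) \<inter> ?h ` (I - J - J) = {}"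
        using f(2) g(2) by fastforce
    qed
    moreover have "J \<union> (I - J) = I" using J(2) by blast
    ultimately have "inj_on ?h I" by simp
    moreover have "\<forall>i\<in>I. ?h i \<in> A i" using f(2) g(2) by auto
    ultimately show ?thesis by blast
  next
    case False
    show ?thesis
    proof (cases "I = {}")
      case True
      then show ?thesis by simp
    next
      case nonempty: False
      then obtain i where i: "i \<in> I" by blast
      have "card {i} \<le> card (\<Union>j\<in>{i}. A j)" using i by (intro hall) auto
      then have "A i \<noteq> {}" by auto
      then obtain x where x: "x \<in> A i" by blast
      have "I - {i} \<subset> I" using i by blast
      then have "\<exists>g. inj_on g (I - {i}) \<and> (\<forall>j\<in>I - {i}. g j \<in> A j - {x})"
      proof (rule psubset.IH)
        show "finite (A j - {x})" if "j \<in> I - {i}" for j using that finA by blast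
        show "card K \<le> card (\<Union>j\<in>K. A j - {x})" if K: "K \<subseteq> I - {i}" for K
        proof (cases "K = {}")
          case True
          then show ?thesis by simp
        next
          case nonemptyK: False
          have "K \<subset> I" using K i by blast
          then have "card K \<le> card (\<Union>j\<in>K. A j)" by (intro hall) blast
          moreover have "card (\<Union>j\<in>K. A j) \<noteq> card K"
            using False nonemptyK \<open>K \<subset> I\<close> by blast
          \<comment> \<open>Without tight proper subsets every such \<open>K\<close> has a neighbour
            to spare, which pays for the loss of \<open>x\<close>.\<close>
          ultimately have "card K \<le> card (\<Union>j\<in>K. A j) - 1" by linarith
          also have "\<dots> \<le> card ((\<Union>j\<in>K. A j) - {x})"
            using diff_card_le_card_Diff[of "{x}" "\<Union>j\<in>K. A j"] by simp
          also have "(\<Union>j\<in>K. A j) - {x} = (\<Union>j\<in>K. A j - {x})" by blast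
          finally show ?thesis .
        qed
      qed
      then obtain g where g: "inj_on g (I - {i})" "\<And>j. j \<in> I - {i} \<Longrightarrow> g j \<in> A j - {x}"
        by blast
      have "inj_on (g(i := x)) (insert i (I - {i}))"
        unfolding inj_on_insert
      proof
        show "inj_on (g(i := x)) (I - {i})" using g(1) by (simp add: inj_on_def)
        show "(g(i := x)) i \<notin> (g(i := x)) ` (I - {i} - {i})" using g(2) by fastforce
      qed
      then have "inj_on (g(i := x)) I" using i by (simp add: insert_absorb)
      moreover have "\<forall>j\<in>I. (g(i := x)) j \<in> A j" using g(2) x by auto
      ultimately show ?thesis by blast
    qed
  qed
qed

text \<open>Hall's condition by double counting: the weight sent out by \<open>J\<close> is
  \<open>card J\<close>, and each of its neighbours receives at most 1.\<close>

lemma matching_of_fractional_matching: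
  fixes w :: "'a \<Rightarrow> 'b \<Rightarrow> real"
  assumes "finite I" "\<And>i. i \<in> I \<Longrightarrow> finite (A i)"
    and nonneg: "\<And>i j. i \<in> I \<Longrightarrow> j \<in> A i \<Longrightarrow> 0 \<le> w i j"
    and out: "\<And>i. i \<in> I \<Longrightarrow> (\<Sum>j\<in>A i. w i j) = 1"
    and "in": "\<And>j. (\<Sum>i\<in>{i\<in>I. j \<in> A i}. w i j) \<le> 1"
  shows "\<exists>f. inj_on f I \<and> (\<forall>i\<in>I. f i \<in> A i)"
  using assms(1,2)
proof (rule hall)
  fix J assume J: "J \<subseteq> I"
  have finJ: "finite J" using J assms(1) by (rule finite_subset)
  let ?U = "\<Union>i\<in>J. A i"
  have finU: "finite ?U" using finJ assms(2) J by (intro finite_UN_I) auto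
  have "real (card J) = (\<Sum>i\<in>J. \<Sum>j\<in>A i. w i j)"
    using out J by (simp add: subset_iff)
  also have "\<dots> = (\<Sum>i\<in>J. \<Sum>j\<in>{j\<in>?U. j \<in> A i}. w i j)"
    by (intro sum.cong refl) auto
  also have "\<dots> = (\<Sum>j\<in>?U. \<Sum>i\<in>{i\<in>J. j \<in> A i}. w i j)"
    using finJ finU by (rule sum.swap_restrict)
  also have "\<dots> \<le> (\<Sum>j\<in>?U. 1)"
  proof (rule sum_mono)
    fix j
    have "(\<Sum>i\<in>{i\<in>J. j \<in> A i}. w i j) \<le> (\<Sum>i\<in>{i\<in>I. j \<in> A i}. w i j)"
      using assms(1) J nonneg by (intro sum_mono2) auto
    with "in"[of j] show "(\<Sum>i\<in>{i\<in>J. j \<in> A i}. w i j) \<le> 1" by linarith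
  qed
  finally show "card J \<le> card ?U" by simp
qed

section \<open>The weights\<close>

text \<open>Here \<open>K\<close> is the size of the lower graph \<open>H\<close>, \<open>b\<close>
  its number of bridges, \<open>c\<close> the number of non-edges that destroy a bridge, and
  \<open>s\<close> the number of breaking edges of a graph above \<open>H\<close> with the same
  bridges. The first factor on the left is the weight this graph sends to \<open>H\<close>; at most
  \<open>K - c\<close> graphs send such a weight, and the right side is the capacity left after the
  \<open>c\<close> reduced weights.\<close>

lemma weight_inequality:
  fixes K S b s c :: real
  assumes "0 < K" "1 \<le> S" "0 \<le> c" "s \<le> S" "b * S \<le> c" "b = 0 \<and> c = 0 \<or> 1 \<le> b"
    "b + s < K + 1"
  shows "(1 - s * ((1 - 1 / S) / K)) / (K + 1 - b - s) * (K - c) \<le> 1 - c * ((1 - 1 / S) / K)"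
proof -
  define y where "y = 1 - 1 / S"
  have y: "0 \<le> y" using assms(2) by (simp add: y_def)
  have bc: "b \<le> c / S" using assms(2,5) by (simp add: pos_le_divide_eq)
  have sS: "s / S \<le> 1" using assms(2,4) by simp
  \<comment> \<open>After clearing denominators, the difference of the two sides is \<open>K\<close>
    times the first expression plus the second one. If \<open>b = 0\<close>, both \<open>c\<close>
    terms vanish and \<open>s \<le> S\<close> suffices; if \<open>1 \<le> b\<close>, then
    \<open>b \<le> c / S\<close> suffices as well.\<close>
  have "0 \<le> 1 - b + (c - s) / S \<and> 0 \<le> c * y * (b - 1)"
    using assms(6)
  proof
    assume "b = 0 \<and> c = 0"
    then show ?thesis using sS by simp
  next
    assume "1 \<le> b"
    then show ?thesis using bc sS y assms(3) by (simp add: diff_divide_distrib)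
  qed
  then have "0 \<le> K * (1 - b + (c - s) / S) + c * y * (b - 1)"
    using assms(1) by simp
  also have "(c - s) / S = (c - s) * (1 - y)"
    by (simp add: y_def)
  finally have "(K - s * y) * (K - c) \<le> (K - c * y) * (K + 1 - b - s)"
    by (simp add: algebra_simps)
  then have "(K - s * y) * (K - c) / (K * (K + 1 - b - s)) \<le> (K - c * y) / K"
    using assms(1,7) by (simp add: divide_le_eq)
  moreover have "1 - s * (y / K) = (K - s * y) / K" "1 - c * (y / K) = (K - c * y) / K"
    using assms(1) by (simp_all add: diff_divide_distrib)
  ultimately show ?thesis
    by (simp add: y_def[symmetric])
qed

section \<open>The fractional matching between consecutive levels\<close>

lemma card_insert_cgraphs:
  assumes "finite V" "H \<in> cgraphs V k" "e \<in> pairs V - H"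
  shows "insert e H \<in> cgraphs V (Suc k)"
proof -
  have "finite H"
    using assms(2) finite_pairs[OF assms(1)] by (auto simp: cgraphs_def intro: finite_subset)
  moreover have "\<forall>f\<in>pairs V. joined (insert e H) f"
    using assms(2) joined_mono[of H _ "insert e H"] by (auto simp: cgraphs_def)
  ultimately show ?thesis
    using assms(2,3) by (auto simp: cgraphs_def)
qed

lemma cgraphs_Diff_nonbridge:
  assumes "E \<in> cgraphs V k" "e \<in> E - bridges E"
  shows "E - {e} \<in> cgraphs V (k - 1)"
proof -
  have "card e = 2" using assms pairs_card by (auto simp: cgraphs_def)
  from nonbridge_joined_iff[OF assms(2) this] show ?thesis
    using assms by (auto simp: cgraphs_def)
qed

text \<open>The index \<open>k\<close> belongs to the lower level: the matched graphs have
  \<open>k + 1\<close> edges, which turns the \<open>k - 1\<close> in the denominator of the reduced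
  weight into \<open>k\<close>.\<close>

lemma cgraphs_matching:
  assumes "finite V" "22 \<le> card V" "card V choose 2 \<le> 2 * k"
  shows "\<exists>f. inj_on f (cgraphs V (Suc k)) \<and>
    (\<forall>E\<in>cgraphs V (Suc k). f E \<in> cgraphs V k \<and> f E \<subseteq> E)"
proof -
  define n where "n = card V"
  define S where "S = 2 * real n / 3"
  define \<beta> where "\<beta> = (1 - 1 / S) / real k"
  \<comment> \<open>The breaking edges receive \<beta> each; the remaining weight is shared by the
    non-bridges that are not breaking, whose number is the denominator.\<close>
  define \<alpha> where "\<alpha> E = (1 - real (card (breaking E)) * \<beta>)
    / (real k + 1 - real (card (bridges E)) - real (card (breaking E)))" for E :: "'a set set"
  \<comment> \<open>The deleted edge need not be named: a non-bridge is breaking exactly if its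
    deletion changes the set of bridges.\<close>
  define w where "w E H = (if bridges H = bridges E then \<alpha> E else \<beta>)" for E H :: "'a set set"
  define N where "N E = (\<lambda>e. E - {e}) ` (E - bridges E)" for E :: "'a set set"
  have finP: "finite (pairs V)" using assms(1) by (rule finite_pairs)
  have n: "22 \<le> n" using assms(2) by (simp add: n_def)
  \<comment> \<open>The aim is \<open>n < k\<close>. Bridges and breaking edges together number less
    than \<open>n / 3 + 2 * n / 3\<close>, so the denominator of \<alpha> is positive.\<close>
  have "int n * 21 \<le> int n * (int n - 1)" using n by (intro mult_left_mono) auto
  moreover have "n choose 2 \<le> 2 * k" using assms(3) by (simp only: n_def)
  ultimately have kn: "n < k" using two_times_choose_two[of n] n by linarith
  then have K: "0 < real k" using n by simp
  have S: "1 \<le> S" using n by (simp add: S_def)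
  have \<beta>: "0 \<le> \<beta>" "\<beta> \<le> 1 / real k"
    using S K by (simp_all add: \<beta>_def divide_right_mono)
  have E_props: "finite E \<and> E \<subseteq> pairs V \<and> card E = Suc k \<and> 3 * card (breaking E) < 2 * n \<and>
      3 * card (bridges E) < n" if "E \<in> cgraphs V (Suc k)" for E
  proof -
    have E: "E \<subseteq> pairs V" "card E = Suc k" using that by (auto simp: cgraphs_def)
    have "card V choose 2 \<le> 2 * Suc k" using assms(3) by simp
    then have "3 * card (bridges E) < card V" "3 * card (breaking E) < 2 * card V"
      using card_bridges_less[OF assms(1,2) that] card_breaking_less[OF assms(1,2) E(1)] E(2)
      by simp_all
    then show ?thesis
      using E finite_subset[OF E(1) finP] by (simp add: n_def)
  qed
  have den: "0 < real k + 1 - real (card (bridges E)) - real (card (breaking E))"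
    and s_le: "real (card (breaking E)) \<le> S"
    and \<alpha>_nonneg: "0 \<le> \<alpha> E" if "E \<in> cgraphs V (Suc k)" for E
  proof -
    have "card (bridges E) + card (breaking E) < k" "card (breaking E) \<le> k"
      using E_props[OF that] kn by linarith+
    then show den: "0 < real k + 1 - real (card (bridges E)) - real (card (breaking E))"
      by linarith
    show "real (card (breaking E)) \<le> S" using E_props[OF that] by (simp add: S_def)
    have "real (card (breaking E)) * \<beta> \<le> real k * (1 / real k)"
      using \<beta> \<open>card (breaking E) \<le> k\<close> by (intro mult_mono) auto
    then show "0 \<le> \<alpha> E" using den K by (simp add: \<alpha>_def)
  qed
  have "\<exists>f. inj_on f (cgraphs V (Suc k)) \<and> (\<forall>E\<in>cgraphs V (Suc k). f E \<in> N E)"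
  proof (rule matching_of_fractional_matching[where w = w])
    have "cgraphs V (Suc k) \<subseteq> Pow (pairs V)" by (auto simp: cgraphs_def)
    then show "finite (cgraphs V (Suc k))" using finP by (simp add: finite_subset)
  next
    fix E assume "E \<in> cgraphs V (Suc k)"
    then show "finite (N E)" using E_props by (simp add: N_def)
  next
    fix E H assume "E \<in> cgraphs V (Suc k)" "H \<in> N E"
    then show "0 \<le> w E H" using \<alpha>_nonneg \<beta> by (simp add: w_def)
  next
    fix E assume E: "E \<in> cgraphs V (Suc k)"
    note props = E_props[OF E]
    let ?R = "E - bridges E - breaking E"
    have fin: "finite ?R" "finite (breaking E)" "finite (bridges E)"
      using props bridges_subset[of E] by (auto simp: breaking_def intro: finite_subset)
    have split: "E - bridges E = breaking E \<union> ?R" by (auto simp: breaking_def)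
    have disj: "breaking E \<inter> ?R = {}" by blast
    have "inj_on (\<lambda>e. E - {e}) (E - bridges E)" by (rule inj_onI) blast
    then have "(\<Sum>H\<in>N E. w E H) = (\<Sum>e\<in>E - bridges E. w E (E - {e}))"
      unfolding N_def by (subst sum.reindex) simp_all
    also have "\<dots> = (\<Sum>e\<in>breaking E. w E (E - {e})) + (\<Sum>e\<in>?R. w E (E - {e}))"
      using fin(2,1) disj by (subst split) (rule sum.union_disjoint)
    also have "(\<Sum>e\<in>breaking E. w E (E - {e})) = (\<Sum>e\<in>breaking E. \<beta>)"
      by (intro sum.cong) (auto simp: w_def breaking_def)
    also have "(\<Sum>e\<in>?R. w E (E - {e})) = (\<Sum>e\<in>?R. \<alpha> E)"
      by (intro sum.cong) (auto simp: w_def breaking_def)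
    finally have sum: "(\<Sum>H\<in>N E. w E H) = card (breaking E) * \<beta> + card ?R * \<alpha> E"
      by simp
    have "card (E - bridges E) = card (breaking E) + card ?R"
      using fin(2,1) disj by (subst split) (rule card_Un_disjoint)
    moreover have "card (bridges E) \<le> card E"
      using props bridges_subset[of E] by (intro card_mono) auto
    then have "card E = card (E - bridges E) + card (bridges E)"
      using card_Diff_subset[OF fin(3) bridges_subset] by linarith
    ultimately have "real (card ?R)
        = real k + 1 - real (card (bridges E)) - real (card (breaking E))"
      using props by simp
    then show "(\<Sum>H\<in>N E. w E H) = 1"
      using den[OF E] by (simp add: sum \<alpha>_def)
  next
    fix H
    let ?G = "{E \<in> cgraphs V (Suc k). H \<in> N E}"
    show "(\<Sum>E\<in>?G. w E H) \<le> 1"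
    proof (cases "?G = {}")
      case True
      then show ?thesis by (simp only: sum.empty)
    next
      case False
      then obtain E where E: "E \<in> cgraphs V (Suc k)" "H \<in> N E" by blast
      have H: "H \<in> cgraphs V k"
        using E cgraphs_Diff_nonbridge[OF E(1)] by (auto simp: N_def)
      have H': "H \<subseteq> pairs V" "card H = k" using H by (auto simp: cgraphs_def)
      define C where "C = {e \<in> pairs V - H. bridges (insert e H) \<noteq> bridges H}"
      define I where "I = {e \<in> pairs V - H. bridges (insert e H) = bridges H}"
      have fin: "finite I" "finite C" using finP by (auto simp: I_def C_def)
      have IC: "pairs V - H = I \<union> C" "I \<inter> C = {}" by (auto simp: I_def C_def)
      have up: "insert e H \<in> cgraphs V (Suc k)" if "e \<in> pairs V - H" for e
        using assms(1) H that by (rule card_insert_cgraphs)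
      have "?G \<subseteq> (\<lambda>e. insert e H) ` (pairs V - H)"
      proof
        fix E assume E: "E \<in> ?G"
        then obtain e where "e \<in> E" "H = E - {e}" by (auto simp: N_def)
        moreover have "E \<subseteq> pairs V" using E by (auto simp: cgraphs_def)
        ultimately show "E \<in> (\<lambda>e. insert e H) ` (pairs V - H)"
          by (intro image_eqI[of _ _ e]) auto
      qed
      then have "(\<Sum>E\<in>?G. w E H) \<le> (\<Sum>E\<in>(\<lambda>e. insert e H) ` (pairs V - H). w E H)"
        using finP up \<alpha>_nonneg \<beta>(1) by (intro sum_mono2) (auto simp: w_def)
      also have "\<dots> = (\<Sum>e\<in>pairs V - H. w (insert e H) H)"
        by (subst sum.reindex) (auto simp: inj_on_def)
      also have "\<dots> = (\<Sum>e\<in>I. w (insert e H) H) + (\<Sum>e\<in>C. w (insert e H) H)"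
        unfolding IC(1) using fin IC(2) by (rule sum.union_disjoint)
      also have "(\<Sum>e\<in>C. w (insert e H) H) = (\<Sum>e\<in>C. \<beta>)"
        by (intro sum.cong) (auto simp: w_def C_def)
      also have "(\<Sum>e\<in>I. w (insert e H) H) = (\<Sum>e\<in>I. \<alpha> (insert e H))"
        by (intro sum.cong) (auto simp: w_def I_def)
      finally have sum: "(\<Sum>E\<in>?G. w E H) \<le> (\<Sum>e\<in>I. \<alpha> (insert e H)) + card C * \<beta>"
        by simp
      have "card (pairs V) = card (H \<union> (pairs V - H))"
        using H'(1) by (simp add: Un_absorb1)
      also have "\<dots> = card H + card (pairs V - H)"
        using finP H'(1) by (intro card_Un_disjoint) (auto intro: finite_subset)
      also have "card (pairs V - H) = card I + card C"
        unfolding IC(1) using fin IC(2) by (rule card_Un_disjoint)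
      \<comment> \<open>\<open>H\<close> contains at least half of all pairs, so it has at most
        \<open>k\<close> non-edges.\<close>
      finally have IC_le: "card I + card C \<le> k"
        using assms(3) H'(2) by (simp add: card_pairs[OF assms(1)])
      have "real (card C) * \<beta> \<le> real k * (1 / real k)"
        using \<beta> IC_le by (intro mult_mono) auto
      then have C\<beta>: "real (card C) * \<beta> \<le> 1" using K by simp
      have "(\<Sum>e\<in>I. \<alpha> (insert e H)) \<le> 1 - card C * \<beta>"
      proof (cases "I = {}")
        case True
        then show ?thesis using C\<beta> by simp
      next
        case False
        then have "card I > 0" using fin(1) by (simp add: card_gt_0_iff)
        then have c: "real (card C) < real k" using IC_le by linarith
        have bC: "2 * n * card (bridges H) \<le> 3 * card C"
          unfolding n_def C_def using assms(1,2) H assms(3) by (rule card_bridges_le_card_changing)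
        have zero: "C = {}" if "bridges H = {}"
          using that bridges_insert_subset[OF H] by (auto simp: C_def)
        have finB: "finite (bridges H)"
          using bridges_subset[of H] H'(1) finP by (meson finite_subset)
        \<comment> \<open>Edges in \<open>I\<close> preserve the bridges, so all these graphs share
          the number \<open>b\<close> of \<open>H\<close>; only the number of breaking edges varies,
          and it drops out of the bound.\<close>
        have bound: "\<alpha> (insert e H) \<le> (1 - card C * \<beta>) / (real k - card C)" if e: "e \<in> I" for e
        proof -
          have E: "insert e H \<in> cgraphs V (Suc k)" using e by (intro up) (simp add: I_def)
          have B: "bridges (insert e H) = bridges H" using e by (simp add: I_def)
          have "\<alpha> (insert e H) * (real k - card C) \<le> 1 - card C * \<beta>"
            unfolding \<alpha>_def \<beta>_def B
          proof (rule weight_inequality)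
            have "real (2 * n * card (bridges H)) \<le> real (3 * card C)"
              using bC by (simp only: of_nat_le_iff)
            then show "real (card (bridges H)) * S \<le> real (card C)"
              by (simp add: S_def algebra_simps)
            show "real (card (bridges H)) = 0 \<and> real (card C) = 0 \<or> 1 \<le> real (card (bridges H))"
              using zero finB by (cases "bridges H = {}") (auto simp: Suc_le_eq card_gt_0_iff)
            show "real (card (bridges H)) + real (card (breaking (insert e H))) < real k + 1"
              using den[OF E] by (simp add: B)
          qed (use K S s_le[OF E] in auto)
          then show ?thesis using c by (simp add: pos_le_divide_eq)
        qed
        have "(\<Sum>e\<in>I. \<alpha> (insert e H)) \<le> card I * ((1 - card C * \<beta>) / (real k - card C))"
          using bound by (rule sum_bounded_above)
        \<comment> \<open>At most \<open>k - c\<close> terms occur, and the common bound is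
          nonnegative because \<open>c\<close> reduced weights sum to at most 1.\<close>
        also have "\<dots> \<le> (real k - card C) * ((1 - card C * \<beta>) / (real k - card C))"
          using C\<beta> c IC_le by (intro mult_right_mono) auto
        also have "\<dots> = 1 - card C * \<beta>" using c by simp
        finally show ?thesis .
      qed
      with sum show ?thesis by linarith
    qed
  qed
  then obtain f where f: "inj_on f (cgraphs V (Suc k))" "\<And>E. E \<in> cgraphs V (Suc k) \<Longrightarrow> f E \<in> N E"
    by blast
  have "f E \<in> cgraphs V k \<and> f E \<subseteq> E" if "E \<in> cgraphs V (Suc k)" for E
    using f(2)[OF that] cgraphs_Diff_nonbridge[OF that] by (auto simp: N_def)
  with f(1) show ?thesis by blast
qed

section \<open>Edge sets and graphs\<close>

definition graph_of :: "'a set \<Rightarrow> 'a set set \<Rightarrow> 'a pair_pre_digraph" where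
  "graph_of V E = \<lparr>pverts = V, parcs = {(a, b). {a, b} \<in> E}\<rparr>"

text \<open>Connectedness in the library is strong connectedness of the symmetric closure; a
  symmetric digraph has the same reachability as its closure.\<close>

lemma connected_iff_rtrancl:
  assumes "pair_graph G"
  shows "Digraph_Component.connected (with_proj G) \<longleftrightarrow>
    pverts G \<noteq> {} \<and> (\<forall>u\<in>pverts G. \<forall>v\<in>pverts G. (u, v) \<in> (parcs G)\<^sup>*)"
proof -
  interpret pair_graph G by fact
  have "symmetric (with_proj G)" by (rule sym_arcs)
  then show ?thesis
    by (simp add: Digraph_Component.connected_def strongly_connected_def
        reachable_mk_symmetric_eq reachable_conv)
qed

text \<open>By symmetry no orientation is lost, so a graph on a given vertex set is determined by
  its undirected edges. This carries injectivity over from edge sets to graphs.\<close>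

lemma parcs_eq_undirected_edges:
  assumes "pair_graph G"
  shows "parcs G = {(a, b). {a, b} \<in> undirected_edges G}"
proof -
  interpret pair_graph G by fact
  have "(b, a) \<in> parcs G" if "(a, b) \<in> parcs G" for a b
    using graph_symmetric that by simp
  then show ?thesis
    by (auto simp: undirected_edges_def doubleton_eq_iff)
qed

lemma undirected_edges_cgraphs:
  assumes "G \<in> connected_graphs n j"
  shows "undirected_edges G \<in> cgraphs {1..n} j"
proof -
  have G: "pair_graph G" "pverts G = {1..n}" "Digraph_Component.connected (with_proj G)"
    "card (undirected_edges G) = j"
    using assms by (auto simp: connected_graphs_def)
  interpret pair_graph G by (rule G(1))
  have "undirected_edges G \<subseteq> pairs {1..n}"
    using pair_no_loops in_arcsD1 in_arcsD2 G(2)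
    by (fastforce simp: undirected_edges_def pairs_def)
  moreover have "joined (undirected_edges G) e" if "e \<in> pairs {1..n}" for e
    using that G(2,3) connected_iff_rtrancl[OF G(1)] parcs_eq_undirected_edges[OF G(1)]
    by (auto simp: joined_def conn_def pairs_def subset_iff)
  ultimately show ?thesis using G(4) by (simp add: cgraphs_def)
qed

lemma undirected_edges_graph_of:
  assumes "E \<subseteq> pairs V"
  shows "undirected_edges (graph_of V E) = E"
proof -
  have "\<exists>a b. e = {a, b}" if "e \<in> E" for e
    using that assms pairs_card by (meson card_2E subset_iff)
  then show ?thesis
    by (fastforce simp: undirected_edges_def graph_of_def)
qed

lemma graph_of_connected_graphs:
  assumes "E \<in> cgraphs {1..n} j" "0 < n"
  shows "graph_of {1..n} E \<in> connected_graphs n j"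
proof -
  let ?G = "graph_of {1..n} E"
  have E: "E \<subseteq> pairs {1..n}" "card E = j" "\<And>e. e \<in> pairs {1..n} \<Longrightarrow> joined E e"
    using assms(1) by (auto simp: cgraphs_def)
  have arcD: "a \<in> {1..n} \<and> b \<in> {1..n} \<and> a \<noteq> b \<and> {b, a} \<in> E" if "{a, b} \<in> E" for a b
  proof -
    have "{a, b} \<in> pairs {1..n}" using that E(1) by blast
    then show ?thesis
      using that by (auto simp: pairs_def insert_commute card_insert_if split: if_splits)
  qed
  have fin: "finite (parcs ?G)"
    by (rule finite_subset[of _ "{1..n} \<times> {1..n}"]) (use arcD in \<open>auto simp: graph_of_def\<close>)
  have G: "pair_graph ?G"
    by unfold_locales
      (use arcD fin in \<open>auto simp: graph_of_def symmetric_def arcs_ends_conv sym_def\<close>)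
  have "(u, v) \<in> (parcs ?G)\<^sup>*" if "u \<in> {1..n}" "v \<in> {1..n}" for u v
  proof (cases "u = v")
    case False
    then have "{u, v} \<in> pairs {1..n}" using that by (simp add: pairs_def)
    from E(3)[OF this] show ?thesis by (simp add: conn_def graph_of_def)
  qed simp
  then have "Digraph_Component.connected (with_proj ?G)"
    unfolding connected_iff_rtrancl[OF G] using assms(2) by (simp add: graph_of_def)
  with G show ?thesis
    using undirected_edges_graph_of[OF E(1)] E(2)
    by (simp add: connected_graphs_def) (simp add: graph_of_def)
qed

theorem theorem3p10:
  shows "\<exists>n\<^sub>6 :: nat. \<forall>n > n\<^sub>6.
    (let m = n choose 2; M = nat \<lceil>real m / 2\<rceil> in
      \<forall>k. M + 1 \<le> k \<and> k < M + n \<longrightarrow>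
        (\<exists>f. complete_matching (connected_graphs n k) (connected_graphs n (k - 1)) f))"
proof (rule exI[of _ 21], unfold Let_def, intro allI impI)
  fix n k :: nat
  \<comment> \<open>The threshold 21 supplies the 22 vertices required by the quadratic
    estimate.\<close>
  assume n: "21 < n"
    and k: "nat \<lceil>real (n choose 2) / 2\<rceil> + 1 \<le> k \<and> k < nat \<lceil>real (n choose 2) / 2\<rceil> + n"
  obtain j where j: "k = Suc j" using k by (cases k) auto
  \<comment> \<open>The lower level has \<open>j = k - 1\<close> edges, still at least
    \<open>M\<close>, hence at least half of all pairs.\<close>
  have "nat \<lceil>real (n choose 2) / 2\<rceil> \<le> j" using k j by linarith
  then have j_ge: "real (nat \<lceil>real (n choose 2) / 2\<rceil>) \<le> real j" by (simp only: of_nat_le_iff)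
  have "real (n choose 2) / 2 \<le> real (nat \<lceil>real (n choose 2) / 2\<rceil>)"
    by (rule real_nat_ceiling_ge)
  also note j_ge
  finally have "real (n choose 2) \<le> real (2 * j)" by simp
  then have "card {1..n} choose 2 \<le> 2 * j" by (simp only: of_nat_le_iff card_atLeastAtMost) simp
  then obtain f where f: "inj_on f (cgraphs {1..n} k)"
      "\<And>E. E \<in> cgraphs {1..n} k \<Longrightarrow> f E \<in> cgraphs {1..n} j \<and> f E \<subseteq> E"
    using cgraphs_matching[of "{1..n}" j] n unfolding j by auto
  \<comment> \<open>The matching of edge sets is conjugated by the passage between graphs on
    \<open>{1..n}\<close> and their edge sets.\<close>
  define g where "g G = graph_of {1..n} (f (undirected_edges G))" for G
  have g: "g G \<in> connected_graphs n j" "undirected_edges (g G) = f (undirected_edges G)"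
    "undirected_edges (g G) \<subseteq> undirected_edges G" if "G \<in> connected_graphs n k" for G
  proof -
    have *: "f (undirected_edges G) \<in> cgraphs {1..n} j" "f (undirected_edges G) \<subseteq> undirected_edges G"
      using f(2) undirected_edges_cgraphs[OF that] by blast+
    show "g G \<in> connected_graphs n j"
      unfolding g_def using *(1) n by (intro graph_of_connected_graphs) auto
    show eq: "undirected_edges (g G) = f (undirected_edges G)"
      unfolding g_def using *(1) by (intro undirected_edges_graph_of) (simp add: cgraphs_def)
    show "undirected_edges (g G) \<subseteq> undirected_edges G"
      using *(2) by (simp only: eq)
  qed
  have "inj_on g (connected_graphs n k)"
  proof (rule inj_onI)
    fix G G' assume G: "G \<in> connected_graphs n k" "G' \<in> connected_graphs n k" "g G = g G'"
    then have "f (undirected_edges G) = f (undirected_edges G')"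
      using g(2) by metis
    then have "undirected_edges G = undirected_edges G'"
      using f(1) G(1,2) undirected_edges_cgraphs by (blast dest: inj_onD)
    moreover have pG: "pair_graph G" "pair_graph G'" "pverts G = pverts G'"
      using G(1,2) by (auto simp: connected_graphs_def)
    ultimately have "parcs G = parcs G'"
      using parcs_eq_undirected_edges[OF pG(1)] parcs_eq_undirected_edges[OF pG(2)] by (simp only:)
    with pG(3) show "G = G'" by simp
  qed
  then have "complete_matching (connected_graphs n k) (connected_graphs n (k - 1)) g"
    using g j by (auto simp: complete_matching_def comparable_def)
  then show "\<exists>f. complete_matching (connected_graphs n k) (connected_graphs n (k - 1)) f"
    by blast
qed

end
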